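(* Let $n$ be a $2$-near perfect number with omitted divisors $d_1$ and $d_2$, and assume $n = 2^k p$ where $p$ is prime and $k$ is a positive integer. Then, after possibly interchanging $d_1$ and $d_2$, one of the following four situations holds: (1) $p = 2^k - 1$, with $d_1 = 1$ and $d_2 = p$; (2) $p = 2^{k+1} - 2^a - 2^b - 1$ for some natural numbers $a, b$, with $d_1 = 2^a$ and $d_2 = 2^b$; (3) $p = \dfrac{2^{k+1} - 2^a - 1}{1 + 2^b}$ for some natural numbers $a, b$, with $d_1 = 2^a$ and $d_2 = 2^b p$; (4) $p = \dfrac{2^{k+1} - 1}{1 + 2^a + 2^b}$ for some natural numbers $a, b$, with $d_1 = 2^a p$ and $d_2 = 2^b p$.
   Context: $\sigma(n)$ denotes the sum of the positive divisors of $n$. A positive integer $n$ is called $2$-near perfect if $\sigma(n) = 2n + d_1 + d_2$ for some two distinct positive divisors $d_1, d_2$ of $n$; these $d_1, d_2$ are called the omitted divisors. *)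

theory Defs
  imports Complex_Main "HOL-Computational_Algebra.Primes"
begin

definition divisor_sum :: "nat \<Rightarrow> nat" where
  "divisor_sum n = \<Sum>{d. d dvd n}"

definition omitted_divisors :: "nat \<Rightarrow> nat \<Rightarrow> nat \<Rightarrow> bool" where
  "omitted_divisors n d\<^sub>1 d\<^sub>2 \<longleftrightarrow>
     d\<^sub>1 dvd n \<and> d\<^sub>2 dvd n \<and> d\<^sub>1 \<noteq> d\<^sub>2 \<and> divisor_sum n = 2 * n + d\<^sub>1 + d\<^sub>2"

text \<open>Positivity of \<open>n\<close> excludes the degenerate case \<open>n = 0\<close>, where every number is a
  divisor; for positive \<open>n\<close> the divisors are automatically positive.\<close>

definition two_near_perfect :: "nat \<Rightarrow> bool" where
  "two_near_perfect n \<longleftrightarrow> 0 < n \<and> (\<exists>d\<^sub>1 d\<^sub>2. omitted_divisors n d\<^sub>1 d\<^sub>2)"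

end

theory Submission
  imports Defs
begin

text \<open>If \<open>p = 2\<close> then \<open>n\<close> is a power of two, which is deficient. Otherwise
  \<open>\<sigma>(n) = (2\<^sup>k\<^sup>+\<^sup>1 - 1)(p + 1)\<close>, so the defining equation becomes
  \<open>p = 2\<^sup>k\<^sup>+\<^sup>1 - 1 - d\<^sub>1 - d\<^sub>2\<close>, where each \<open>d\<^sub>i\<close> has the form \<open>2\<^sup>a\<close> or \<open>2\<^sup>a p\<close>.
  Solving for \<open>p\<close> gives situations (2) to (4); situation (1) is (3) with \<open>a = b = 0\<close>.\<close>

text \<open>A divisor of a product is a product of divisors of the two factors. The prime
  \<open>p = 2\<close> is included; the two forms then overlap.\<close>

lemma dvd_two_power_prime_iff:
  fixes p :: nat
  assumes "prime p"
  shows "d dvd 2 ^ k * p \<longleftrightarrow> (\<exists>a\<le>k. d = 2 ^ a \<or> d = 2 ^ a * p)"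
proof
  assume "d dvd 2 ^ k * p"
  then obtain u v where uv: "d = u * v" "u dvd 2 ^ k" "v dvd p"
    using division_decomp by blast
  then obtain a where "a \<le> k" "u = 2 ^ a"
    using divides_primepow_nat[of 2 u k] two_is_prime_nat by blast
  moreover have "v = 1 \<or> v = p"
    using assms uv(3) by (auto simp: prime_nat_iff)
  ultimately show "\<exists>a\<le>k. d = 2 ^ a \<or> d = 2 ^ a * p"
    using uv(1) by auto
next
  assume "\<exists>a\<le>k. d = 2 ^ a \<or> d = 2 ^ a * p"
  then show "d dvd 2 ^ k * p"
    using le_imp_power_dvd[of _ k "2 :: nat"] by (metis dvd_mult2 dvd_refl mult_dvd_mono)
qed

lemma sum_two_powers: "(\<Sum>i\<le>k. 2 ^ i) = (2 ^ (k + 1) - 1 :: nat)"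
  by (induction k) auto

lemma divisor_sum_two_power: "divisor_sum (2 ^ k) = 2 ^ (k + 1) - 1"
proof -
  have "{d. d dvd 2 ^ k} = (\<lambda>i. 2 ^ i :: nat) ` {..k}"
    using divides_primepow_nat[OF two_is_prime_nat] by auto
  then have "divisor_sum (2 ^ k) = (\<Sum>i\<le>k. 2 ^ i)"
    unfolding divisor_sum_def by (simp add: sum.reindex inj_on_def)
  then show ?thesis
    by (simp add: sum_two_powers)
qed

text \<open>For odd \<open>p\<close> the divisors \<open>2 ^ i\<close> and \<open>2 ^ i * p\<close>
  are never equal, so no divisor is counted twice and the sum splits into two geometric
  sums.\<close>

lemma divisor_sum_two_power_odd_prime:
  assumes "prime p" "odd p"
  shows "divisor_sum (2 ^ k * p) = (2 ^ (k + 1) - 1) * (p + 1)"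
proof -
  let ?A = "(\<lambda>i. 2 ^ i :: nat) ` {..k}" and ?B = "(\<lambda>i. 2 ^ i * p) ` {..k}"
  have "{d. d dvd 2 ^ k * p} = ?A \<union> ?B"
    unfolding dvd_two_power_prime_iff[OF assms(1)] by auto
  moreover have "?A \<inter> ?B = {}"
  proof -
    have "2 ^ i \<noteq> 2 ^ j * p" for i j :: nat
    proof
      assume "2 ^ i = 2 ^ j * p"
      then have "p dvd 2 ^ i"
        by simp
      then have "p dvd 2"
        using assms(1) prime_dvd_power by blast
      then show False
        using primes_dvd_imp_eq[OF assms(1) two_is_prime_nat] assms(2) by simp
    qed
    then show ?thesis
      by auto
  qed
  ultimately have "divisor_sum (2 ^ k * p) = \<Sum>?A + \<Sum>?B"
    unfolding divisor_sum_def by (simp add: sum.union_disjoint)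
  also have "\<Sum>?A = (\<Sum>i\<le>k. 2 ^ i)"
    by (simp add: sum.reindex inj_on_def)
  also have "\<Sum>?B = (\<Sum>i\<le>k. 2 ^ i) * p"
    using prime_gt_0_nat[OF assms(1)] by (simp add: sum.reindex inj_on_def sum_distrib_right)
  finally show ?thesis
    by (simp add: sum_two_powers algebra_simps)
qed

theorem theorem1:
  fixes n k p d\<^sub>1 d\<^sub>2 :: nat
  assumes "two_near_perfect n"
    and "omitted_divisors n d\<^sub>1 d\<^sub>2"
    and "n = 2 ^ k * p"
    and "prime p"
    and "0 < k"
  shows "\<exists>x y. (x = d\<^sub>1 \<and> y = d\<^sub>2 \<or> x = d\<^sub>2 \<and> y = d\<^sub>1) \<and>
    ((real p = 2 ^ k - 1 \<and> x = 1 \<and> y = p)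
   \<or> (\<exists>a b :: nat. real p = 2 ^ (k + 1) - 2 ^ a - 2 ^ b - 1 \<and> x = 2 ^ a \<and> y = 2 ^ b)
   \<or> (\<exists>a b :: nat. real p = (2 ^ (k + 1) - 2 ^ a - 1) / (1 + 2 ^ b) \<and> x = 2 ^ a \<and> y = 2 ^ b * p)
   \<or> (\<exists>a b :: nat. real p = (2 ^ (k + 1) - 1) / (1 + 2 ^ a + 2 ^ b) \<and> x = 2 ^ a * p \<and> y = 2 ^ b * p))"
proof -
  have dvd: "d\<^sub>1 dvd 2 ^ k * p" "d\<^sub>2 dvd 2 ^ k * p"
    and sigma: "divisor_sum (2 ^ k * p) = 2 * (2 ^ k * p) + d\<^sub>1 + d\<^sub>2"
    using assms(2,3) by (auto simp: omitted_divisors_def)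
  have "p \<noteq> 2"
  proof
    assume "p = 2"
    then have "2 ^ (k + 2) - 1 = 2 ^ (k + 2) + d\<^sub>1 + d\<^sub>2"
      using sigma divisor_sum_two_power[of "k + 1"] by (simp add: mult.commute)
    \<comment> \<open>Truncated subtraction gives \<open>0 - 1 = 0\<close>, so the contradiction
      depends on the power being positive.\<close>
    moreover have "2 ^ (k + 2) > (0 :: nat)"
      by simp
    ultimately show False
      by linarith
  qed
  then have "odd p"
    using assms(4) prime_odd_nat prime_ge_2_nat by (metis le_neq_implies_less)
  then have "(2 ^ (k + 1) - 1) * (p + 1) = 2 ^ (k + 1) * p + d\<^sub>1 + d\<^sub>2"
    using divisor_sum_two_power_odd_prime[OF assms(4), of k] sigma by simp
  \<comment> \<open>Over the reals, subtraction and division are exact; the truncated difference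
    carries over because \<open>2 ^ (k + 1)\<close> is at least 1.\<close>
  then have "real ((2 ^ (k + 1) - 1) * (p + 1)) = real (2 ^ (k + 1) * p + d\<^sub>1 + d\<^sub>2)"
    by simp
  moreover have "real (2 ^ (k + 1) - 1) = 2 ^ (k + 1) - 1"
    by (simp add: of_nat_diff_if)
  ultimately have "(2 ^ (k + 1) - 1) * (real p + 1) = 2 ^ (k + 1) * real p + real d\<^sub>1 + real d\<^sub>2"
    by (simp only: of_nat_mult of_nat_add of_nat_power of_nat_1 of_nat_numeral)
  \<comment> \<open>After expansion \<open>2 ^ (k + 1) * p\<close> cancels, which leaves an equation
    linear in \<open>p\<close> in each of the cases below.\<close>
  then have key: "real p + real d\<^sub>1 + real d\<^sub>2 = 2 ^ (k + 1) - 1"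
    by (simp add: algebra_simps)
  obtain a where a: "d\<^sub>1 = 2 ^ a \<or> d\<^sub>1 = 2 ^ a * p"
    using dvd(1) dvd_two_power_prime_iff[OF assms(4)] by blast
  obtain b where b: "d\<^sub>2 = 2 ^ b \<or> d\<^sub>2 = 2 ^ b * p"
    using dvd(2) dvd_two_power_prime_iff[OF assms(4)] by blast
  \<comment> \<open>These are the denominators in situations (3) and (4).\<close>
  have pos: "1 + 2 ^ i \<noteq> (0 :: real)" "1 + 2 ^ i + 2 ^ j \<noteq> (0 :: real)" for i j :: nat
    using zero_less_power[of "2 :: real" i] zero_less_power[of "2 :: real" j] by linarith+
  consider
      "d\<^sub>1 = 2 ^ a" "d\<^sub>2 = 2 ^ b"
    | "d\<^sub>1 = 2 ^ a" "d\<^sub>2 = 2 ^ b * p"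
    | "d\<^sub>1 = 2 ^ a * p" "d\<^sub>2 = 2 ^ b"
    | "d\<^sub>1 = 2 ^ a * p" "d\<^sub>2 = 2 ^ b * p"
    using a b by blast
  then show ?thesis
  proof cases
    case 1
    then have "real p = 2 ^ (k + 1) - 2 ^ a - 2 ^ b - 1"
      using key by simp
    with 1 show ?thesis
      by (intro exI[of _ d\<^sub>1] exI[of _ d\<^sub>2]) blast
  next
    case 2
    then have "real p = (2 ^ (k + 1) - 2 ^ a - 1) / (1 + 2 ^ b)"
      using key unfolding nonzero_eq_divide_eq[OF pos(1)] by (simp add: algebra_simps)
    with 2 show ?thesis
      by (intro exI[of _ d\<^sub>1] exI[of _ d\<^sub>2]) blast
  next
    case 3
    \<comment> \<open>Mirror image of the previous case: the exponents trade roles, and the divisors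
      are interchanged when the witnesses are given.\<close>
    then have "real p = (2 ^ (k + 1) - 2 ^ b - 1) / (1 + 2 ^ a)"
      using key unfolding nonzero_eq_divide_eq[OF pos(1)] by (simp add: algebra_simps)
    with 3 show ?thesis
      by (intro exI[of _ d\<^sub>2] exI[of _ d\<^sub>1]) blast
  next
    case 4
    then have "real p = (2 ^ (k + 1) - 1) / (1 + 2 ^ a + 2 ^ b)"
      using key unfolding nonzero_eq_divide_eq[OF pos(2)] by (simp add: algebra_simps)
    with 4 show ?thesis
      by (intro exI[of _ d\<^sub>1] exI[of _ d\<^sub>2]) blast
  qed
qed

end
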